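(* Define $sf(n,3)$ for integers $n$ by $sf(n,3)=0$ for $n<0$, $sf(0,3)=1$, and for $n>0$: $sf(n,3)=sf(n/3,3)$ if $3\mid n$, and $sf(n,3)=sf(n-r,3)+sf(n-3,3)$ if $n\equiv r\pmod 3$ with $r\in\{1,2\}$. Then: (a) for every $j\ge0$, $\sum_{r=0}^{2j+1}sf(r,3)\equiv0\pmod 2$; (b) for every even $j\ge0$, $sf(3j+4,3)=sf(3j+5,3)\equiv0\pmod2$; (c) for all $j\ge0$ and $r\ge2$, $sf(3^rj+4,3)=sf(3^rj+5,3)\equiv0\pmod2$.
   Context: $sf(n,3)$ is the number of semi-$3$-Fibonacci partitions of $n$, characterized by the stated recurrence. *)

theory Defs
  imports "HOL-Number_Theory.Cong"
begin

function sf3 :: "int \<Rightarrow> nat" where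
  "sf3 n =
    (if n < 0 then 0
     else if n = 0 then 1
     else if 3 dvd n then sf3 (n div 3)
     else sf3 (n - n mod 3) + sf3 (n - 3))"
  by pat_completeness auto
termination
proof (relation "measure nat")
  fix n :: int
  assume "\<not> n < 0" "n \<noteq> 0" "\<not> 3 dvd n"
  moreover from this have "n mod 3 > 0"
    by (simp add: dvd_eq_mod_eq_0 order_less_le)
  ultimately show "(n - n mod 3, n) \<in> measure nat"
    by simp
qed auto

declare sf3.simps [simp del]

end

theory Submission
  imports Defs
begin

text \<open>
  Unfolding the recurrence gives \<open>S(n) := sf(3n+1) = sf(3n+2) = \<Sum>i\<le>n. sf(i)\<close>, so all three claims
  concern the parity of \<open>S\<close>. A block \<open>sf(3i) + sf(3i+1) + sf(3i+2) = sf(i) + 2S(i)\<close> contributes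
  \<open>sf(i)\<close> modulo 2, whence \<open>S(3m) \<equiv> S(3m+2) \<equiv> S(m)\<close> and \<open>S(3m+1) \<equiv> 2S(m) \<equiv> 0\<close>.
  Descending along \<open>n \<mapsto> n div 3\<close>, an odd \<open>n\<close> stays odd until it is 1 modulo 3, so \<open>S(n)\<close> is even.
\<close>

lemma sf3_mult_3: "sf3 (3 * n) = sf3 n"
  by (cases "n = 0") (simp_all add: sf3.simps[of "3 * n"] sf3.simps[of n])

text \<open>The argument 3n - 2 is written so that this reads S(n) = sf(n) + S(n - 1), with S(-1) =
  0.\<close>

lemma sf3_3n_plus_1_rec: "0 \<le> n \<Longrightarrow> sf3 (3 * n + 1) = sf3 n + sf3 (3 * (n - 1) + 1)"
proof -
  assume "0 \<le> n"
  moreover have "\<not> 3 dvd 3 * n + 1" "(3 * n + 1) mod 3 = 1"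
    by presburger+
  ultimately show ?thesis
    using sf3_mult_3[of n] by (simp add: sf3.simps[of "3 * n + 1"])
qed

lemma sf3_3n_plus_2_rec: "0 \<le> n \<Longrightarrow> sf3 (3 * n + 2) = sf3 n + sf3 (3 * (n - 1) + 2)"
proof -
  assume "0 \<le> n"
  moreover have "\<not> 3 dvd 3 * n + 2" "(3 * n + 2) mod 3 = 2"
    by presburger+
  ultimately show ?thesis
    using sf3_mult_3[of n] by (simp add: sf3.simps[of "3 * n + 2"])
qed

lemma sf3_neg: "n < 0 \<Longrightarrow> sf3 n = 0"
  by (simp add: sf3.simps)

text \<open>Both sides obey the same recurrence and vanish at n = -1, where the arguments are
  negative.\<close>

lemma sf3_3n_plus_2: "0 \<le> n \<Longrightarrow> sf3 (3 * n + 2) = sf3 (3 * n + 1)"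
proof (induction n rule: int_ge_induct)
  case base
  show ?case
    using sf3_3n_plus_1_rec[of 0] sf3_3n_plus_2_rec[of 0] by (simp add: sf3_neg)
next
  case (step n)
  then show ?case
    using sf3_3n_plus_1_rec[of "n + 1"] sf3_3n_plus_2_rec[of "n + 1"] by simp
qed

lemma sum_sf3: "0 \<le> n \<Longrightarrow> (\<Sum>i = 0..n. sf3 i) = sf3 (3 * n + 1)"
proof (induction n rule: int_ge_induct)
  case base
  show ?case
    using sf3_3n_plus_1_rec[of 0] by (simp add: sf3_neg)
next
  case (step n)
  have "{0..n + 1} = insert (n + 1) {0..n}"
    using step.hyps by auto
  with step show ?case
    using sf3_3n_plus_1_rec[of "n + 1"] by simp
qed

lemma even_sf3_block:
  assumes "0 \<le> m"
  shows "even (sf3 (3 * (3 * m + 2) + 1)) \<longleftrightarrow> even (sf3 (3 * m + 1))"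
    and "even (sf3 (3 * (3 * m) + 1)) \<longleftrightarrow> even (sf3 (3 * m + 1))"
    and "even (sf3 (3 * (3 * m + 1) + 1))"
proof -
  define S where "S n = sf3 (3 * n + 1)" for n
  have S_rec: "S (3 * n) = sf3 n + S (3 * n - 1)" "S (3 * n + 1) = S n + S (3 * n)"
    "S (3 * n + 2) = S n + S (3 * n + 1)" "S n = sf3 n + S (n - 1)" if "0 \<le> n" for n
    using that sf3_3n_plus_1_rec[of "3 * n"] sf3_3n_plus_1_rec[of "3 * n + 1"]
      sf3_3n_plus_1_rec[of "3 * n + 2"] sf3_3n_plus_1_rec[of n]
    by (simp_all add: S_def sf3_mult_3 sf3_3n_plus_2)
  \<comment> \<open>Starting at -1, where both sides are S(-1) = 0, lets \<open>S0\<close> use this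
    at m - 1 even for m = 0.\<close>
  have S2: "even (S (3 * n + 2)) \<longleftrightarrow> even (S n)" if "-1 \<le> n" for n
    using that
  proof (induction n rule: int_ge_induct)
    case base
    show ?case
      by (simp add: S_def sf3_neg)
  next
    case (step n)
    then show ?case
      using S_rec[of "n + 1"] by (auto simp: algebra_simps)
  qed
  \<comment> \<open>As 3m - 1 = 3(m - 1) + 2, S(3m) = sf(m) + S(3m - 1) is congruent to sf(m) + S(m
    - 1) = S(m).\<close>
  have S0: "even (S (3 * m)) \<longleftrightarrow> even (S m)"
    using S2[of "m - 1"] S_rec(1,4)[OF assms] assms by (simp add: algebra_simps)
  with S2[of m] S_rec(2)[OF assms] assms
  show "even (sf3 (3 * (3 * m + 2) + 1)) \<longleftrightarrow> even (sf3 (3 * m + 1))"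
    and "even (sf3 (3 * (3 * m) + 1)) \<longleftrightarrow> even (sf3 (3 * m + 1))"
    and "even (sf3 (3 * (3 * m + 1) + 1))"
    by (simp_all add: S_def)
qed

lemma even_sf3_3n_plus_1: "0 \<le> n \<Longrightarrow> odd n \<Longrightarrow> even (sf3 (3 * n + 1))"
proof (induction "nat n" arbitrary: n rule: less_induct)
  case less
  define m where "m = n div 3"
  \<comment> \<open>Oddness excludes n = 0, the fixed point of the descent.\<close>
  have m: "0 \<le> m" "m < n"
    using less.prems unfolding m_def by presburger+
  have "n = 3 * m \<and> odd m \<or> n = 3 * m + 1 \<or> n = 3 * m + 2 \<and> odd m"
    using less.prems(2) unfolding m_def by presburger
  then consider "n = 3 * m" "odd m" | "n = 3 * m + 1" | "n = 3 * m + 2" "odd m"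
    by blast
  then show ?case
    using less.hyps[of m] m even_sf3_block[of m] by cases auto
qed

theorem theorem6:
  shows "(\<forall>j::int. 0 \<le> j \<longrightarrow> [(\<Sum>r = 0..2 * j + 1. sf3 r) = 0] (mod 2)) \<and>
    (\<forall>j::int. 0 \<le> j \<longrightarrow> even j \<longrightarrow>
       sf3 (3 * j + 4) = sf3 (3 * j + 5) \<and> [sf3 (3 * j + 5) = 0] (mod 2)) \<and>
    (\<forall>(j::int) (r::nat). 0 \<le> j \<longrightarrow> 2 \<le> r \<longrightarrow>
       sf3 (3 ^ r * j + 4) = sf3 (3 ^ r * j + 5) \<and> [sf3 (3 ^ r * j + 5) = 0] (mod 2))"
proof (intro conjI allI impI)
  fix j :: int
  assume "0 \<le> j"
  then show "[(\<Sum>r = 0..2 * j + 1. sf3 r) = 0] (mod 2)"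
    using even_sf3_3n_plus_1[of "2 * j + 1"] by (simp add: sum_sf3 cong_0_iff)
next
  fix j :: int
  assume "0 \<le> j" "even j"
  \<comment> \<open>The value is S(j + 1), and j + 1 is odd.\<close>
  then show "sf3 (3 * j + 4) = sf3 (3 * j + 5)" "[sf3 (3 * j + 5) = 0] (mod 2)"
    using even_sf3_3n_plus_1[of "j + 1"] sf3_3n_plus_2[of "j + 1"]
    by (simp_all add: cong_0_iff algebra_simps)
next
  fix j :: int and r :: nat
  assume j: "0 \<le> j" and "2 \<le> r"
  \<comment> \<open>Two factors 3 are split off: with m = \<open>3 ^ s * j\<close>,
    \<open>3 ^ r * j + 4\<close> equals 3(3m + 1) + 1, so the value is S(3m + 1), which is even
    whatever the parity of j.\<close>
  then obtain s where r: "r = Suc (Suc s)"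
    by (metis Suc_le_D numeral_2_eq_2 Suc_le_mono)
  have "0 \<le> 3 ^ s * j"
    using j by simp
  then show "sf3 (3 ^ r * j + 4) = sf3 (3 ^ r * j + 5)" "[sf3 (3 ^ r * j + 5) = 0] (mod 2)"
    using even_sf3_block(3)[of "3 ^ s * j"] sf3_3n_plus_2[of "3 * (3 ^ s * j) + 1"]
    by (simp_all add: r cong_0_iff algebra_simps)
qed

end
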